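(* Let $r\ge 1$ be an integer, let $\alpha_1,\ldots,\alpha_r,\beta>-1$ be real with $\alpha_i-\alpha_j\notin\mathbb{Z}$ for $i\neq j$, and let $q_1,\ldots,q_r>0$ be real with $q_1+\cdots+q_r=1$. For $n\in\mathbb{N}$ put $\vec{n}=(n_1,\ldots,n_r)$ with $n_j=\lfloor q_j n\rfloor$, and $|\vec{n}|=n_1+\cdots+n_r$ (so that $|\vec{n}|/n\to 1$ as $n\to\infty$). Let $P_{\vec{n}}$ be the Jacobi-Piñeiro polynomial with multi-index $\vec{n}$ and parameters $\alpha_1,\ldots,\alpha_r,\beta$. Then \[ \lim_{n\to\infty} (-1)^{|\vec{n}|}\prod_{j=1}^r \frac{(|\vec{n}|+\alpha_j+\beta+1)_{n_j}}{(\alpha_j+1)_{n_j}}\, P_{\vec{n}}\left(\frac{z}{n^{r+1}}\right) = {}_0F_r(-;\alpha_1+1,\ldots,\alpha_r+1;-q_1\cdots q_r z), \] uniformly for $z$ in compact subsets of $\mathbb{C}$.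
   Context: Notation: $(a)_k=a(a+1)\cdots(a+k-1)$, $(a)_0=1$, is the Pochhammer symbol, and ${}_0F_r(-;b_1,\ldots,b_r;z)=\sum_{k=0}^\infty \frac{z^k}{(b_1)_k\cdots(b_r)_k\,k!}$. The Jacobi-Piñeiro polynomial $P_{\vec{n}}$, for a multi-index $\vec{n}=(n_1,\ldots,n_r)$ of nonnegative integers, is the polynomial of degree $|\vec{n}|$ defined by the Rodrigues formula (for $x\in(0,1)$) \[ (-1)^{|\vec{n}|}\prod_{j=1}^r(|\vec{n}|+\alpha_j+\beta+1)_{n_j}\,(1-x)^\beta P_{\vec{n}}(x)=\prod_{j=1}^r\left(x^{-\alpha_j}\frac{d^{n_j}}{dx^{n_j}}x^{n_j+\alpha_j}\right)(1-x)^{|\vec{n}|+\beta}, \] where the product on the right is a product (composition) of differential operators (which commute), each consisting of multiplication by $x^{n_j+\alpha_j}$, then differentiating $n_j$ times, then multiplication by $x^{-\alpha_j}$, all applied to $(1-x)^{|\vec{n}|+\beta}$. These polynomials satisfy $\int_0^1 P_{\vec{n}}(x)x^k x^{\alpha_j}(1-x)^\beta\,dx=0$ for $0\le k\le n_j-1$, $1\le j\le r$. *)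

theory Defs
  imports "HOL-Analysis.Analysis" "HOL-Computational_Algebra.Polynomial"
begin

text \<open>
  Families indexed by \<open>1, \<dots>, r\<close> are functions on \<^typ>\<open>nat\<close>; only their values on
  \<open>{1..r}\<close> are used.
\<close>

definition multi_size :: "nat \<Rightarrow> (nat \<Rightarrow> nat) \<Rightarrow> nat"
  where "multi_size r n = (\<Sum>j=1..r. n j)"

text \<open>
  The operator \<open>x\<^sup>-\<^sup>a \<circ> (d/dx)\<^sup>m \<circ> x\<^sup>m\<^sup>+\<^sup>a\<close>. It is only meaningful on the open
  interval \<open>(0,1)\<close>; as differentiation is local, the values taken by \<open>powr\<close> elsewhere
  do not affect the result there.
\<close>

definition rodrigues_op :: "real \<Rightarrow> nat \<Rightarrow> (real \<Rightarrow> real) \<Rightarrow> real \<Rightarrow> real"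
  where "rodrigues_op a m f =
    (\<lambda>x. x powr (- a) * (deriv ^^ m) (\<lambda>y. y powr (real m + a) * f y) x)"

text \<open>The factor with index 1 is applied last.\<close>

definition rodrigues_prod ::
    "nat \<Rightarrow> (nat \<Rightarrow> nat) \<Rightarrow> (nat \<Rightarrow> real) \<Rightarrow> (real \<Rightarrow> real) \<Rightarrow> real \<Rightarrow> real"
  where "rodrigues_prod r n \<alpha> = foldr (\<circ>) (map (\<lambda>j. rodrigues_op (\<alpha> j) (n j)) [1..<Suc r]) id"

definition is_jacobi_pineiro ::
    "nat \<Rightarrow> (nat \<Rightarrow> nat) \<Rightarrow> (nat \<Rightarrow> real) \<Rightarrow> real \<Rightarrow> real poly \<Rightarrow> bool"
  where "is_jacobi_pineiro r n \<alpha> \<beta> p \<longleftrightarrow>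
    degree p = multi_size r n \<and>
    (\<forall>x\<in>{0<..<1}.
       (-1) ^ multi_size r n
         * (\<Prod>j=1..r. pochhammer (real (multi_size r n) + \<alpha> j + \<beta> + 1) (n j))
         * (1 - x) powr \<beta> * poly p x
       = rodrigues_prod r n \<alpha> (\<lambda>y. (1 - y) powr (real (multi_size r n) + \<beta>)) x)"

text \<open>
  For \<open>\<alpha>\<^sub>j, \<beta> > -1\<close> the Pochhammer factors do not vanish, so the Rodrigues formula
  determines the polynomial on \<open>(0,1)\<close>, and hence uniquely.
\<close>

definition jacobi_pineiro ::
    "nat \<Rightarrow> (nat \<Rightarrow> nat) \<Rightarrow> (nat \<Rightarrow> real) \<Rightarrow> real \<Rightarrow> real poly"
  where "jacobi_pineiro r n \<alpha> \<beta> = (THE p. is_jacobi_pineiro r n \<alpha> \<beta> p)"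

definition hypergeom_0F :: "nat \<Rightarrow> (nat \<Rightarrow> complex) \<Rightarrow> complex \<Rightarrow> complex"
  where "hypergeom_0F r b z =
    (\<Sum>k. z ^ k / ((\<Prod>j=1..r. pochhammer (b j) k) * fact k))"

definition floor_index :: "(nat \<Rightarrow> real) \<Rightarrow> nat \<Rightarrow> nat \<Rightarrow> nat"
  where "floor_index q n j = nat \<lfloor>q j * real n\<rfloor>"

end

theory Submission imports Defs "HOL-Complex_Analysis.Complex_Analysis" begin

text \<open>
  Expanding \<open>(1 - x)\<close> to the power \<open>s + \<beta>\<close>, where \<open>s\<close> is the degree, and applying the Rodrigues
  operators termwise shows that \<open>(1 - x) powr \<beta>\<close> times the normalised polynomial is the series with
  coefficients \<open>(-s - \<beta>)\<^sub>k / k! * \<Prod>\<^sub>j (\<alpha>\<^sub>j + n\<^sub>j + 1)\<^sub>k / (\<alpha>\<^sub>j + 1)\<^sub>k\<close>; by analytic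
  continuation this holds in the complex unit disc. After the substitution \<open>x = z / n\<^sup>r\<^sup>+\<^sup>1\<close> each coefficient
  converges to that of the limit. Consecutive factors of a rescaled coefficient are at most
  \<open>B / (y + i) + 1 / n\<close>, hence eventually smaller than any given \<open>\<epsilon>\<close>, which yields a summable majorant uniform
  in \<open>n\<close>, and Tannery's theorem gives uniform convergence; the factor \<open>(1 - x) powr (-\<beta>)\<close> tends to 1.
\<close>

section \<open>Locality of higher derivatives on the open unit interval\<close>

lemma higher_deriv_cong_open:
  assumes "open S" "x \<in> S" "\<And>y. y \<in> S \<Longrightarrow> f y = g y"
  shows "(deriv ^^ m) f x = (deriv ^^ m) g x"
  using assms by (intro higher_deriv_cong_ev refl) (auto simp: eventually_nhds)

text \<open>The innermost derivative is peeled off, and a closed form for it is needed only on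
  (0,1), because the remaining derivatives are local. Both inductions on the number of
  differentiations below rest on this.\<close>

lemma higher_deriv_Suc_cong:
  fixes f g :: "real \<Rightarrow> real"
  assumes "x \<in> {0<..<1}"
    and "\<And>y. y \<in> {0<..<1} \<Longrightarrow> (f has_real_derivative g y) (at y)"
  shows "(deriv ^^ Suc m) f x = (deriv ^^ m) g x"
  unfolding funpow_Suc_right o_apply
  using assms by (intro higher_deriv_cong_open[of "{0<..<1}"]) (auto intro: DERIV_imp_deriv)

lemma rodrigues_op_cong:
  assumes "x \<in> {0<..<1}" "\<And>y. y \<in> {0<..<1} \<Longrightarrow> f y = g y"
  shows "rodrigues_op a m f x = rodrigues_op a m g x"
  unfolding rodrigues_op_def
  using assms by (auto intro!: higher_deriv_cong_open[of "{0<..<1}"])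

section \<open>Existence of the Jacobi-Pineiro polynomial\<close>

text \<open>The polynomial factor that remains when
  \<open>y powr c * (1 - y) powr \<gamma> * poly p y\<close> is differentiated and the powers of
  \<open>y\<close> and \<open>1 - y\<close>, each lowered by one, are split off.\<close>

definition jacobi_step :: "real \<Rightarrow> real \<Rightarrow> real poly \<Rightarrow> real poly"
  where "jacobi_step c \<gamma> p =
    smult c ([:1, -1:] * p) + [:0, 1:] * ([:1, -1:] * pderiv p) - smult \<gamma> ([:0, 1:] * p)"

lemma has_real_derivative_jacobi_step:
  assumes x: "x \<in> {0<..<1}"
  shows "((\<lambda>y. y powr (c + 1) * ((1 - y) powr (\<gamma> + 1) * poly p y)) has_real_derivative
    x powr c * ((1 - x) powr \<gamma> * poly (jacobi_step (c + 1) (\<gamma> + 1) p) x)) (at x)"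
proof -
  have e: "x powr (c + 1) = x * x powr c" "(1 - x) powr (\<gamma> + 1) = (1 - x) * (1 - x) powr \<gamma>"
    using x by (simp_all add: powr_add)
  have "((\<lambda>y. y powr (c + 1) * ((1 - y) powr (\<gamma> + 1) * poly p y)) has_real_derivative
      (c + 1) * x powr c * ((1 - x) powr (\<gamma> + 1) * poly p x)
      + x powr (c + 1) * (- (\<gamma> + 1) * (1 - x) powr \<gamma> * poly p x
          + (1 - x) powr (\<gamma> + 1) * poly (pderiv p) x)) (at x)"
    using x by (auto intro!: derivative_eq_intros simp: algebra_simps)
  also have "(c + 1) * x powr c * ((1 - x) powr (\<gamma> + 1) * poly p x)
      + x powr (c + 1) * (- (\<gamma> + 1) * (1 - x) powr \<gamma> * poly p x
          + (1 - x) powr (\<gamma> + 1) * poly (pderiv p) x)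
      = x powr c * ((1 - x) powr \<gamma> * poly (jacobi_step (c + 1) (\<gamma> + 1) p) x)"
    unfolding e jacobi_step_def by (simp add: algebra_simps)
  finally show ?thesis .
qed

text \<open>The three summands contribute \<open>- c\<close>, \<open>- degree p\<close> and
  \<open>- \<gamma>\<close>, each times the leading coefficient of \<open>p\<close>, to the
  coefficient at \<open>Suc (degree p)\<close>; the second hypothesis keeps their sum from
  vanishing.\<close>

lemma degree_jacobi_step:
  assumes "p \<noteq> 0" "c + real (degree p) + \<gamma> \<noteq> 0"
  shows "degree (jacobi_step c \<gamma> p) = Suc (degree p)"
proof (rule antisym)
  have 1: "degree ([:a, b:] * q) \<le> Suc (degree p)"
    if "degree q \<le> degree p" for a b :: real and q
    using degree_mult_le[of "[:a, b:]" q] that degree_pCons_le[of a "[:b:]"] by simp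
  have 2: "degree ([:0, 1:] * ([:1, -1:] * pderiv p)) \<le> Suc (degree p)"
  proof (cases "degree p = 0")
    case True
    then have "pderiv p = 0" by (simp add: pderiv_eq_0_iff)
    then show ?thesis by simp
  next
    case False
    have "degree ([:1, -1:] * pderiv p) \<le> degree [:1, -1::real:] + degree (pderiv p)"
      by (rule degree_mult_le)
    also have "\<dots> \<le> degree p" using False by (simp add: degree_pderiv)
    finally show ?thesis by (rule 1)
  qed
  show "degree (jacobi_step c \<gamma> p) \<le> Suc (degree p)"
    unfolding jacobi_step_def
    by (intro degree_diff_le degree_add_le order.trans[OF degree_smult_le] 1 2 order.refl)
  have "coeff (jacobi_step c \<gamma> p) (Suc (degree p)) = - (c + real (degree p) + \<gamma>) * lead_coeff p"
    by (cases "degree p")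
       (simp_all add: jacobi_step_def coeff_pderiv coeff_eq_0 algebra_simps)
  then have "coeff (jacobi_step c \<gamma> p) (Suc (degree p)) \<noteq> 0"
    using assms by simp
  then show "Suc (degree p) \<le> degree (jacobi_step c \<gamma> p)" by (rule le_degree)
qed

text \<open>Each differentiation raises the degree by one and lowers the exponent of \<open>1 - x\<close> by one,
  so their sum stays constant and the leading factor never vanishes.\<close>

lemma rodrigues_op_powr_poly:
  assumes "p \<noteq> 0" "m > 0 \<Longrightarrow> a + real (degree p) + \<gamma> + 1 > 0"
  shows "\<exists>q. q \<noteq> 0 \<and> degree q = degree p + m \<and>
    (\<forall>x\<in>{0<..<1}. rodrigues_op a m (\<lambda>y. (1 - y) powr \<gamma> * poly p y) x
      = (1 - x) powr (\<gamma> - real m) * poly q x)"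
proof -
  \<comment> \<open>The induction concerns the iterated derivative alone and leaves
    \<open>x powr a\<close> in front; the outer factor \<open>x powr (- a)\<close> of the operator
    cancels it at the end.\<close>
  have "\<exists>q. q \<noteq> 0 \<and> degree q = degree p + m \<and>
    (\<forall>x\<in>{0<..<1}. (deriv ^^ m) (\<lambda>y. y powr (real m + a) * ((1 - y) powr \<gamma> * poly p y)) x
      = x powr a * ((1 - x) powr (\<gamma> - real m) * poly q x))"
    using assms
  proof (induction m arbitrary: p \<gamma>)
    case 0
    then show ?case by (intro exI[of _ p]) auto
  next
    case (Suc m)
    define p' where "p' = jacobi_step (real m + a + 1) \<gamma> p"
    have deg: "degree p' = Suc (degree p)"
      unfolding p'_def using Suc.prems by (intro degree_jacobi_step) auto
    then have "p' \<noteq> 0" by auto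
    moreover have "a + real (degree p') + (\<gamma> - 1) + 1 > 0"
      using Suc.prems deg by simp
    ultimately obtain q where q: "q \<noteq> 0" "degree q = degree p' + m"
      "\<And>x. x \<in> {0<..<1} \<Longrightarrow>
        (deriv ^^ m) (\<lambda>y. y powr (real m + a) * ((1 - y) powr (\<gamma> - 1) * poly p' y)) x
          = x powr a * ((1 - x) powr (\<gamma> - 1 - real m) * poly q x)"
      using Suc.IH[of p' "\<gamma> - 1"] by blast
    have "(deriv ^^ Suc m) (\<lambda>y. y powr (real (Suc m) + a) * ((1 - y) powr \<gamma> * poly p y)) x
        = (deriv ^^ m) (\<lambda>y. y powr (real m + a) * ((1 - y) powr (\<gamma> - 1) * poly p' y)) x"
      if "x \<in> {0<..<1}" for x
      using has_real_derivative_jacobi_step[of _ "real m + a" "\<gamma> - 1" p]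
      by (intro higher_deriv_Suc_cong[OF that]) (simp add: p'_def add_ac)
    then show ?case using q deg
      by (intro exI[of _ q]) (simp add: diff_diff_eq add_ac del: funpow.simps)
  qed
  then obtain q where q: "q \<noteq> 0" "degree q = degree p + m"
    "\<And>x. x \<in> {0<..<1} \<Longrightarrow>
      (deriv ^^ m) (\<lambda>y. y powr (real m + a) * ((1 - y) powr \<gamma> * poly p y)) x
        = x powr a * ((1 - x) powr (\<gamma> - real m) * poly q x)"
    by blast
  then show ?thesis
    by (intro exI[of _ q]) (auto simp: rodrigues_op_def powr_minus field_simps)
qed

text \<open>After \<open>d\<close> differentiations the exponent of \<open>1 - x\<close> is
  \<open>\<gamma> - d\<close> and the degree is \<open>d\<close>, so the positivity condition for
  the next factor is always \<open>\<alpha> i + \<gamma> + 1 > 0\<close>. Distinctness makes the sum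
  over the set agree with the sum along the list.\<close>

lemma rodrigues_list_powr:
  assumes "distinct js"
    and "\<And>j. j \<in> set js \<Longrightarrow> n j > 0 \<Longrightarrow> \<alpha> j + \<gamma> + 1 > 0"
  shows "\<exists>p. p \<noteq> 0 \<and> degree p = (\<Sum>j\<in>set js. n j) \<and>
    (\<forall>x\<in>{0<..<1}. foldr (\<circ>) (map (\<lambda>j. rodrigues_op (\<alpha> j) (n j)) js) id (\<lambda>y. (1 - y) powr \<gamma>) x
      = (1 - x) powr (\<gamma> - real (\<Sum>j\<in>set js. n j)) * poly p x)"
  using assms
proof (induction js)
  case Nil
  show ?case by (intro exI[of _ 1]) auto
next
  case (Cons i js)
  define d where "d = (\<Sum>j\<in>set js. n j)"
  have "distinct js" "\<And>j. j \<in> set js \<Longrightarrow> n j > 0 \<Longrightarrow> \<alpha> j + \<gamma> + 1 > 0"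
    using Cons.prems by auto
  from Cons.IH[OF this, folded d_def] obtain p where p: "p \<noteq> 0" "degree p = d"
    "\<And>x. x \<in> {0<..<1} \<Longrightarrow>
      foldr (\<circ>) (map (\<lambda>j. rodrigues_op (\<alpha> j) (n j)) js) id (\<lambda>y. (1 - y) powr \<gamma>) x
        = (1 - x) powr (\<gamma> - real d) * poly p x"
    by blast
  have "n i > 0 \<Longrightarrow> \<alpha> i + real (degree p) + (\<gamma> - real d) + 1 > 0"
    using Cons.prems p by simp
  note rodrigues_op_powr_poly[of p "n i" "\<alpha> i" "\<gamma> - real d", OF p(1) this]
  then obtain q where q: "q \<noteq> 0" "degree q = d + n i"
    "\<And>x. x \<in> {0<..<1} \<Longrightarrow>
      rodrigues_op (\<alpha> i) (n i) (\<lambda>y. (1 - y) powr (\<gamma> - real d) * poly p y) x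
        = (1 - x) powr (\<gamma> - real d - real (n i)) * poly q x"
    unfolding p(2) by blast
  have "foldr (\<circ>) (map (\<lambda>j. rodrigues_op (\<alpha> j) (n j)) (i # js)) id (\<lambda>y. (1 - y) powr \<gamma>) x
      = (1 - x) powr (\<gamma> - real (d + n i)) * poly q x" if "x \<in> {0<..<1}" for x
    using q(3)[OF that] rodrigues_op_cong[OF that p(3)] by (simp add: diff_diff_eq)
  moreover have S: "(\<Sum>j\<in>set (i # js). n j) = d + n i"
    using Cons.prems by (simp add: d_def)
  ultimately show ?case unfolding S using q(1,2) by blast
qed

text \<open>For \<open>m = 0\<close> the symbol is the empty product. Otherwise
  \<open>s \<ge> 1\<close>, and then \<open>s + 1 \<ge> 2\<close> outweighs
  \<open>\<alpha> + \<beta> > -2\<close>; with \<open>s = 0\<close> the base itself could be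
  negative.\<close>

lemma pochhammer_jacobi_pos:
  fixes \<alpha> \<beta> :: real
  assumes "\<alpha> > -1" "\<beta> > -1" "m \<le> s"
  shows "pochhammer (real s + \<alpha> + \<beta> + 1) m > 0"
  using assms by (cases "m = 0") (auto intro!: pochhammer_pos)

text \<open>Taking \<open>\<gamma> = s + \<beta>\<close> in \<open>rodrigues_list_powr\<close>
  leaves exactly the power \<beta> of \<open>1 - x\<close> times a polynomial of degree
  \<open>s\<close>; dividing by the nonzero constant \<open>C\<close> gives existence. Uniqueness
  holds because a polynomial vanishing on the infinite set (0,1) is zero.\<close>

lemma is_jacobi_pineiro_jacobi_pineiro:
  assumes \<alpha>: "\<And>j. j \<in> {1..r} \<Longrightarrow> \<alpha> j > -1" and \<beta>: "\<beta> > -1"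
  shows "is_jacobi_pineiro r n \<alpha> \<beta> (jacobi_pineiro r n \<alpha> \<beta>)"
  unfolding jacobi_pineiro_def
proof (rule theI')
  define s where "s = multi_size r n"
  define C where "C = (-1) ^ s * (\<Prod>j=1..r. pochhammer (real s + \<alpha> j + \<beta> + 1) (n j))"
  have le: "n j \<le> s" if "j \<in> {1..r}" for j
    unfolding s_def multi_size_def using that by (intro member_le_sum) auto
  have "pochhammer (real s + \<alpha> j + \<beta> + 1) (n j) > 0" if "j \<in> {1..r}" for j
    using pochhammer_jacobi_pos[OF \<alpha>[OF that] \<beta> le[OF that]] .
  then have C: "C \<noteq> 0" unfolding C_def by fastforce
  have s: "(\<Sum>j\<in>set [1..<Suc r]. n j) = s"
    unfolding s_def multi_size_def by (rule sum.cong) auto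
  have "\<alpha> j + (real s + \<beta>) + 1 > 0" if "j \<in> set [1..<Suc r]" "n j > 0" for j
  proof -
    have "j \<in> {1..r}" using that by auto
    then show ?thesis using \<alpha>[of j] le[of j] that \<beta> by linarith
  qed
  note rodrigues_list_powr[of "[1..<Suc r]" n \<alpha> "real s + \<beta>", OF distinct_upt this, unfolded s]
  then obtain p where p: "degree p = s"
    "\<And>x. x \<in> {0<..<1} \<Longrightarrow>
      rodrigues_prod r n \<alpha> (\<lambda>y. (1 - y) powr (real s + \<beta>)) x = (1 - x) powr \<beta> * poly p x"
    unfolding rodrigues_prod_def by (auto simp del: upt_Suc)
  have iff: "is_jacobi_pineiro r n \<alpha> \<beta> q \<longleftrightarrow>
      degree q = s \<and> (\<forall>x\<in>{0<..<1}. C * poly q x = poly p x)" for q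
    unfolding is_jacobi_pineiro_def using p(2)
    by (auto simp: C_def s_def algebra_simps)
  show "\<exists>!q. is_jacobi_pineiro r n \<alpha> \<beta> q"
  proof (rule ex1I)
    show "is_jacobi_pineiro r n \<alpha> \<beta> (smult (1 / C) p)"
      unfolding iff using p C by simp
  next
    fix q assume "is_jacobi_pineiro r n \<alpha> \<beta> q"
    then have "poly (smult C q - p) x = 0" if "x \<in> {0<..<1}" for x
      unfolding iff using that by simp
    then have "{0<..<1} \<subseteq> {x. poly (smult C q - p) x = 0}" by blast
    then have "smult C q - p = 0"
      using poly_roots_finite infinite_Ioo[of "0::real" 1] finite_subset zero_less_one by metis
    then show "q = smult (1 / C) p" using C by auto
  qed
qed

section \<open>The hypergeometric series of the polynomial\<close>

text \<open>Convergence at a real point \<open>t\<close> between \<open>norm z\<close> and 1 forces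
  convergence at \<open>z\<close>. The type is general because the result serves both the real
  differentiation of series and the complex continuation.\<close>

lemma summable_powser_of_real:
  fixes c :: "nat \<Rightarrow> real" and z :: "'a :: {real_normed_field, banach}"
  assumes "\<And>x. x \<in> {0<..<1} \<Longrightarrow> summable (\<lambda>k. c k * x ^ k)" and "norm z < 1"
  shows "summable (\<lambda>k. of_real (c k) * z ^ k)"
proof -
  obtain t where t: "norm z < t" "t < 1"
    using dense[OF assms(2)] by blast
  then have "0 < t" by (meson le_less_trans norm_ge_zero)
  have "summable (\<lambda>k. of_real (c k * t ^ k) :: 'a)"
    by (rule summable_of_real) (use assms(1) t \<open>0 < t\<close> in auto)
  then have "summable (\<lambda>k. of_real (c k) * (of_real t) ^ k :: 'a)" by simp
  then show ?thesis by (rule powser_inside) (use t \<open>0 < t\<close> in auto)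
qed

text \<open>Termwise differentiation gives \<open>h = (b + 1) * g x + x * g' x\<close>, where the
  second summand has the coefficients \<open>k * c k\<close>. The value \<open>h\<close> comes
  together with its series so that it can feed the next differentiation.\<close>

lemma has_real_derivative_powr_powser:
  fixes c :: "nat \<Rightarrow> real"
  assumes g: "\<And>x. x \<in> {0<..<1} \<Longrightarrow> (\<lambda>k. c k * x ^ k) sums g x" and x: "x \<in> {0<..<1}"
  obtains h where "(\<lambda>k. (b + 1 + real k) * c k * x ^ k) sums h"
    "((\<lambda>y. y powr (b + 1) * g y) has_real_derivative x powr b * h) (at x)"
proof -
  have sm: "summable (\<lambda>k. c k * y ^ k)" if "norm y < 1" for y :: real
    using summable_powser_of_real[of c y] g that by (auto dest: sums_summable)
  define D where "D = (\<Sum>k. diffs c k * x ^ k)"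
  have "((\<lambda>y. \<Sum>k. c k * y ^ k) has_real_derivative D) (at x)"
    unfolding D_def using x by (intro termdiffs_strong'[of 1] sm) auto
  \<comment> \<open>The values of \<open>g\<close> are known only on (0,1), so the derivative of the
    power series is carried over by agreement near \<open>x\<close>.\<close>
  then have dg: "(g has_real_derivative D) (at x)"
    by (rule DERIV_cong_ev[THEN iffD1, rotated -1])
       (use x g in \<open>auto simp: eventually_nhds sums_iff intro!: exI[of _ "{0<..<1}"]\<close>)
  have "summable (\<lambda>k. diffs c k * x ^ k)"
    using x by (intro termdiff_converges[of _ 1] sm) auto
  from diffs_equiv[OF this] have "(\<lambda>k. real k * c k * x ^ (k - Suc 0)) sums D"
    by (simp add: D_def)
  then have "(\<lambda>k. x * (real k * c k * x ^ (k - Suc 0))) sums (x * D)" by (rule sums_mult)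
  \<comment> \<open>Multiplication by \<open>x\<close> restores the exponent \<open>k\<close>; at
    \<open>k = 0\<close> the subtraction is truncated, but both sides vanish.\<close>
  also have "(\<lambda>k. x * (real k * c k * x ^ (k - Suc 0))) = (\<lambda>k. real k * c k * x ^ k)"
    (is "?f = ?g")
  proof
    show "?f k = ?g k" for k by (cases k) auto
  qed
  finally have "(\<lambda>k. (b + 1) * (c k * x ^ k) + real k * c k * x ^ k) sums ((b + 1) * g x + x * D)"
    by (intro sums_add sums_mult g x)
  then have 1: "(\<lambda>k. (b + 1 + real k) * c k * x ^ k) sums ((b + 1) * g x + x * D)"
    by (simp add: algebra_simps)
  have "((\<lambda>y. y powr (b + 1) * g y) has_real_derivative
      (b + 1) * x powr b * g x + x powr (b + 1) * D) (at x)"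
    using x by (auto intro!: derivative_eq_intros dg)
  also have "(b + 1) * x powr b * g x + x powr (b + 1) * D = x powr b * ((b + 1) * g x + x * D)"
    using x by (simp add: powr_add algebra_simps)
  finally have "((\<lambda>y. y powr (b + 1) * g y) has_real_derivative
      x powr b * ((b + 1) * g x + x * D)) (at x)" .
  with 1 show ?thesis by (rule that)
qed

text \<open>Each monomial \<open>x ^ k\<close> is an eigenfunction of the operator with eigenvalue
  \<open>pochhammer (a + k + 1) m\<close>. In the induction the innermost derivative supplies the
  largest factor of this product, and the induction hypothesis supplies the others.\<close>

lemma rodrigues_op_powser:
  assumes g: "\<And>x. x \<in> {0<..<1} \<Longrightarrow> (\<lambda>k. c k * x ^ k) sums g x" and x: "x \<in> {0<..<1}"
  shows "(\<lambda>k. pochhammer (a + real k + 1) m * c k * x ^ k) sums rodrigues_op a m g x"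
proof -
  have "(\<lambda>k. pochhammer (a + real k + 1) m * c k * x ^ k) sums
      (x powr (-a) * (deriv ^^ m) (\<lambda>y. y powr (real m + a) * g y) x)"
    using g x
  proof (induction m arbitrary: c g)
    case 0
    have "x powr a \<noteq> 0" using 0(2) by auto
    then have "x powr - a * (x powr a * g x) = g x" by (simp add: powr_minus)
    with 0(1)[OF 0(2)] show ?case by (simp only: pochhammer_0 funpow_0 of_nat_0 add_0_left mult_1)
  next
    case (Suc m)
    have "\<forall>y\<in>{0<..<1}. \<exists>h. (\<lambda>k. (real m + a + 1 + real k) * c k * y ^ k) sums h \<and>
        ((\<lambda>y. y powr (real m + a + 1) * g y) has_real_derivative y powr (real m + a) * h) (at y)"
      by (intro ballI, rule has_real_derivative_powr_powser[OF Suc.prems(1)]) blast+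
    \<comment> \<open>The sum of the differentiated series is chosen at every point, which makes it
      a function to which the induction hypothesis applies.\<close>
    from bchoice[OF this] obtain h where h:
      "\<And>y. y \<in> {0<..<1} \<Longrightarrow> (\<lambda>k. (real m + a + 1 + real k) * c k * y ^ k) sums h y"
      "\<And>y. y \<in> {0<..<1} \<Longrightarrow>
        ((\<lambda>y. y powr (real m + a + 1) * g y) has_real_derivative y powr (real m + a) * h y) (at y)"
      by blast
    have "(deriv ^^ Suc m) (\<lambda>y. y powr (real (Suc m) + a) * g y) x
        = (deriv ^^ m) (\<lambda>y. y powr (real m + a) * h y) x"
      using h(2) by (intro higher_deriv_Suc_cong Suc.prems) (simp add: add_ac)
    then show ?case
      using Suc.IH[OF h(1) Suc.prems(2)]
      by (simp add: pochhammer_Suc mult_ac add_ac del: funpow.simps)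
  qed
  then show ?thesis by (simp add: rodrigues_op_def)
qed

text \<open>Eigenvalues multiply under composition. The point \<open>x\<close> is generalised in the
  induction because an outer operator needs the series of the inner function on all of
  (0,1).\<close>

lemma rodrigues_list_powser:
  assumes g: "\<And>x. x \<in> {0<..<1} \<Longrightarrow> (\<lambda>k. c k * x ^ k) sums g x" and x: "x \<in> {0<..<1}"
    and "distinct js"
  shows "(\<lambda>k. (\<Prod>j\<in>set js. pochhammer (\<alpha> j + real k + 1) (n j)) * c k * x ^ k) sums
    foldr (\<circ>) (map (\<lambda>j. rodrigues_op (\<alpha> j) (n j)) js) id g x"
  using assms(3) x
proof (induction js arbitrary: x)
  case Nil
  then show ?case using g by simp
next
  case (Cons i js)
  then show ?case
    using rodrigues_op_powser[OF Cons.IH, of x "\<alpha> i" "n i"] by (simp add: mult.assoc)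
qed

text \<open>Newton's binomial series; the sign of \<open>- x\<close> is absorbed by passing from the
  binomial coefficient to the Pochhammer symbol of \<open>- \<gamma>\<close>.\<close>

lemma sums_one_minus_powr:
  assumes "x \<in> {0<..<1::real}"
  shows "(\<lambda>k. pochhammer (- \<gamma>) k / fact k * x ^ k) sums ((1 - x) powr \<gamma>)"
proof -
  have "(\<lambda>k. (\<gamma> gchoose k) * (- x) ^ k) sums ((1 + - x) powr \<gamma>)"
    using assms by (intro Generalised_Binomial_Theorem.gen_binomial_real) auto
  moreover have "(\<gamma> gchoose k) * (- x) ^ k = pochhammer (- \<gamma>) k / fact k * x ^ k" for k
  proof -
    have "(- 1) ^ k * (- x) ^ k = x ^ k"
      by (simp flip: power_mult_distrib)
    moreover have "(\<gamma> gchoose k) * (- x) ^ k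
        = pochhammer (- \<gamma>) k / fact k * ((- 1) ^ k * (- x) ^ k)"
      by (simp add: gbinomial_pochhammer)
    ultimately show ?thesis by simp
  qed
  ultimately show ?thesis by simp
qed

lemma poly_map_poly_of_real:
  "poly (map_poly of_real p) (of_real x) = (of_real (poly p x) :: 'a :: {real_algebra_1, comm_semiring_0})"
  by (induction p) (auto simp: map_poly_pCons)

text \<open>On (0,1) this is the Rodrigues formula with the binomial series expanded termwise. Both
  sides are holomorphic in the unit disc and (0,1) accumulates at 0, so the identity theorem extends
  the equality to complex \<open>z\<close>.\<close>

lemma jacobi_pineiro_sums:
  fixes z :: complex and n :: "nat \<Rightarrow> nat"
  assumes \<alpha>: "\<And>j. j \<in> {1..r} \<Longrightarrow> \<alpha> j > -1" and \<beta>: "\<beta> > -1" and z: "norm z < 1"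
  defines "s \<equiv> multi_size r n"
  shows "(\<lambda>k. complex_of_real ((\<Prod>j=1..r. pochhammer (\<alpha> j + real k + 1) (n j))
        * (pochhammer (- (real s + \<beta>)) k / fact k)) * z ^ k) sums
    ((-1) ^ s * complex_of_real (\<Prod>j=1..r. pochhammer (real s + \<alpha> j + \<beta> + 1) (n j))
      * (1 - z) powr complex_of_real \<beta>
      * poly (map_poly complex_of_real (jacobi_pineiro r n \<alpha> \<beta>)) z)"
proof -
  define p where "p = jacobi_pineiro r n \<alpha> \<beta>"
  define P where "P = (\<Prod>j=1..r. pochhammer (real s + \<alpha> j + \<beta> + 1) (n j))"
  define c where "c k = (\<Prod>j=1..r. pochhammer (\<alpha> j + real k + 1) (n j))
        * (pochhammer (- (real s + \<beta>)) k / fact k)" for k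
  define F where "F w = (-1) ^ s * complex_of_real P * (1 - w) powr complex_of_real \<beta>
      * poly (map_poly complex_of_real p) w" for w
  define G where "G w = (\<Sum>k. complex_of_real (c k) * w ^ k)" for w
  have real: "(\<lambda>k. c k * x ^ k) sums ((-1) ^ s * P * (1 - x) powr \<beta> * poly p x)"
    if "x \<in> {0<..<1}" for x
  proof -
    have "is_jacobi_pineiro r n \<alpha> \<beta> p"
      unfolding p_def by (rule is_jacobi_pineiro_jacobi_pineiro[OF \<alpha> \<beta>])
    then have "(-1) ^ s * P * (1 - x) powr \<beta> * poly p x
        = rodrigues_prod r n \<alpha> (\<lambda>y. (1 - y) powr (real s + \<beta>)) x"
      using that unfolding is_jacobi_pineiro_def P_def s_def by blast
    moreover have "{1..<Suc r} = {1..r}" by auto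
    ultimately show ?thesis
      using rodrigues_list_powser[OF sums_one_minus_powr[of _ "real s + \<beta>"] that distinct_upt[of 1 "Suc r"], of \<alpha> n]
      by (simp add: rodrigues_prod_def c_def mult_ac del: upt_Suc)
  qed
  have sm: "summable (\<lambda>k. complex_of_real (c k) * w ^ k)" if "norm w < 1" for w
    using real that by (intro summable_powser_of_real) (auto dest: sums_summable)
  have hol: "(\<lambda>w. F w - G w) holomorphic_on ball 0 1"
  proof (intro holomorphic_on_diff)
    show "G holomorphic_on ball 0 1"
      by (rule power_series_holomorphic[of 0 1 "\<lambda>k. complex_of_real (c k)"])
         (auto simp: G_def intro!: summable_sums sm)
    \<comment> \<open>In the unit disc \<open>1 - w\<close> has positive real part, so the principal
      branch of the power is holomorphic there.\<close>
    have "1 - w \<notin> \<real>\<^sub>\<le>\<^sub>0" if "norm w < 1" for w :: complex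
      using complex_Re_le_cmod[of w] that by (auto simp: complex_nonpos_Reals_iff)
    then show "F holomorphic_on ball 0 1"
      unfolding F_def by (intro holomorphic_intros) auto
  qed
  have eq: "F w - G w = 0" if "w \<in> complex_of_real ` {0<..<1}" for w
  proof -
    from that obtain x where x: "w = of_real x" "x \<in> {0<..<1}" by blast
    have "(1 - w) powr complex_of_real \<beta> = of_real ((1 - x) powr \<beta>)"
      using x powr_of_real[of "1 - x" \<beta>] by simp
    then have "F w = of_real ((-1) ^ s * P * (1 - x) powr \<beta> * poly p x)"
      unfolding F_def x(1) by (simp add: poly_map_poly_of_real)
    moreover have "(\<lambda>k. complex_of_real (c k * x ^ k)) sums
        of_real ((-1) ^ s * P * (1 - x) powr \<beta> * poly p x)"
      by (rule sums_of_real[OF real[OF x(2)]])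
    ultimately show ?thesis by (simp add: G_def x sums_iff)
  qed
  have lim: "0 islimpt complex_of_real ` {0<..<1}"
    unfolding islimpt_approachable
  proof (intro allI impI)
    fix e :: real assume "e > 0"
    then show "\<exists>x'\<in>complex_of_real ` {0<..<1}. x' \<noteq> 0 \<and> dist x' 0 < e"
      by (intro bexI[of _ "of_real (min e 1 / 2)"] imageI) auto
  qed
  have "complex_of_real ` {0<..<1} \<subseteq> ball 0 1" by auto
  then have "F z - G z = 0"
    by (rule analytic_continuation[OF hol open_ball connected_ball _ _ lim eq]) (use z in simp_all)
  moreover have "(\<lambda>k. complex_of_real (c k) * z ^ k) sums G z"
    unfolding G_def using sm z by (intro summable_sums)
  ultimately show ?thesis unfolding c_def F_def P_def p_def by simp
qed

section \<open>Asymptotics of the rescaled coefficients\<close>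

text \<open>With \<open>k\<close> fixed this is a product of \<open>k\<close> factors
  \<open>(x n + i) / n\<close>, each of which tends to \<open>L\<close>.\<close>

lemma pochhammer_div_power_tendsto:
  fixes x :: "nat \<Rightarrow> real"
  assumes "(\<lambda>n. x n / real n) \<longlonglongrightarrow> L"
  shows "(\<lambda>n. pochhammer (x n) k / real n ^ k) \<longlonglongrightarrow> L ^ k"
proof (induction k)
  case (Suc k)
  have "(\<lambda>n. x n / real n + real k / real n) \<longlonglongrightarrow> L + 0"
    by (intro tendsto_add assms lim_const_over_n)
  from tendsto_mult[OF Suc this]
  have "(\<lambda>n. pochhammer (x n) k / real n ^ k * (x n / real n + real k / real n)) \<longlonglongrightarrow> L ^ Suc k"
    by (simp add: mult.commute)
  also have "(\<lambda>n. pochhammer (x n) k / real n ^ k * (x n / real n + real k / real n))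
      = (\<lambda>n. pochhammer (x n) (Suc k) / real n ^ Suc k)"
    by (simp add: fun_eq_iff pochhammer_Suc mult.commute flip: add_divide_distrib)
  finally show ?case .
qed simp

text \<open>The quotient is a product of factors bounded by \<open>B / (y + i) + 1 / n\<close>. For
  large \<open>n\<close> only a fixed finite number of them can exceed \<epsilon>, and those are
  absorbed into \<open>A\<close>, which does not depend on \<open>x\<close>, \<open>k\<close> or
  \<open>n\<close>.\<close>

lemma pochhammer_ratio_bound:
  fixes y B \<epsilon> :: real
  assumes "y > 0" "B \<ge> 0" "\<epsilon> > 0"
  shows "\<exists>A\<ge>0. \<forall>\<^sub>F n in sequentially. \<forall>x k. \<bar>x\<bar> \<le> B * real n \<longrightarrow>
    \<bar>pochhammer x k\<bar> / (real n ^ k * pochhammer y k) \<le> A * \<epsilon> ^ k"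
proof -
  \<comment> \<open>From index \<open>i0\<close> on, \<open>B / (y + i)\<close> is at most
    \<open>\<epsilon> / 2\<close>, and for \<open>n \<ge> n0\<close> so is \<open>1 / n\<close>. The
    first \<open>i0\<close> factors are bounded by
    \<open>D * \<epsilon> = B / y + \<epsilon>\<close>.\<close>
  obtain i0 :: nat where i0: "2 * B / \<epsilon> < real i0" using reals_Archimedean2 by blast
  define D where "D = (B / y + \<epsilon>) / \<epsilon>"
  have D: "D \<ge> 1" using assms by (simp add: D_def)
  obtain n0 :: nat where n0: "2 / \<epsilon> < real n0" using reals_Archimedean2 by blast
  have "\<forall>\<^sub>F n in sequentially. n \<ge> max n0 1" by (rule eventually_ge_at_top)
  then have "\<forall>\<^sub>F n in sequentially. \<forall>x k. \<bar>x\<bar> \<le> B * real n \<longrightarrow>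
    \<bar>pochhammer x k\<bar> / (real n ^ k * pochhammer y k) \<le> D ^ i0 * \<epsilon> ^ k"
  proof eventually_elim
    case (elim n)
    have n: "n \<ge> 1" using elim by simp
    have "2 / \<epsilon> \<le> real n" using n0 elim by linarith
    then have inv_n: "1 / real n \<le> \<epsilon> / 2" using n assms by (simp add: field_simps)
    have factor: "\<bar>x + real i\<bar> / (real n * (y + real i)) \<le> B / (y + real i) + 1 / real n"
      if "\<bar>x\<bar> \<le> B * real n" for x i
    proof -
      have "\<bar>x + real i\<bar> \<le> B * real n + (y + real i)" using that assms by linarith
      then have "\<bar>x + real i\<bar> / (real n * (y + real i))
          \<le> (B * real n + (y + real i)) / (real n * (y + real i))"
        using assms n by (intro divide_right_mono) auto
      also have "\<dots> = B / (y + real i) + 1 / real n"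
        using assms n by (simp add: field_simps)
      finally show ?thesis .
    qed
    \<comment> \<open>The exponent \<open>min k i0\<close> counts the exceptional factors among the
      first \<open>k\<close>, which makes the bound inductive.\<close>
    have "\<bar>pochhammer x k\<bar> / (real n ^ k * pochhammer y k) \<le> D ^ min k i0 * \<epsilon> ^ k"
      if x: "\<bar>x\<bar> \<le> B * real n" for x k
    proof (induction k)
      case (Suc k)
      have "\<bar>x + real k\<bar> / (real n * (y + real k)) \<le> (if k < i0 then D else 1) * \<epsilon>"
      proof (cases "k < i0")
        case True
        have "B / (y + real k) \<le> B / y" using assms by (intro divide_left_mono) auto
        then have "B / (y + real k) + 1 / real n \<le> B / y + \<epsilon>"
          using inv_n assms by linarith
        then show ?thesis using factor[OF x, of k] True assms by (simp add: D_def)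
      next
        case False
        then have "2 * B / \<epsilon> \<le> y + real k" using i0 assms by linarith
        then have "B / (y + real k) \<le> \<epsilon> / 2" using assms by (simp add: field_simps add_pos_nonneg)
        then have "\<bar>x + real k\<bar> / (real n * (y + real k)) \<le> \<epsilon>"
          using factor[OF x, of k] inv_n by linarith
        then show ?thesis using False by simp
      qed
      then have "\<bar>pochhammer x k\<bar> / (real n ^ k * pochhammer y k)
            * (\<bar>x + real k\<bar> / (real n * (y + real k)))
          \<le> (D ^ min k i0 * \<epsilon> ^ k) * ((if k < i0 then D else 1) * \<epsilon>)"
        using assms D by (intro mult_mono Suc) auto
      also have "\<dots> = D ^ min (Suc k) i0 * \<epsilon> ^ Suc k"
        by (cases "k < i0") (simp_all add: min_absorb1 min_absorb2 mult_ac)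
      finally show ?case by (simp add: pochhammer_Suc abs_mult mult_ac)
    qed simp
    moreover have "D ^ min k i0 * \<epsilon> ^ k \<le> D ^ i0 * \<epsilon> ^ k" for k
      using assms D by (intro mult_right_mono power_increasing) auto
    ultimately show ?case using order_trans by blast
  qed
  moreover have "D ^ i0 \<ge> 0" using D by simp
  ultimately show ?thesis by blast
qed

section \<open>Uniform convergence of power series from convergence of the coefficients\<close>

text \<open>On the disc the difference of the two series is at most the sum of
  \<open>norm (a n k - b k) * R ^ k\<close>, which is free of \<open>z\<close> and tends to 0 by
  Tannery's theorem. Boundedness of the limit is recorded for the later product of two uniform
  limits.\<close>

lemma uniform_limit_powser:
  fixes a :: "nat \<Rightarrow> nat \<Rightarrow> complex"
  assumes lim: "\<And>k. (\<lambda>n. a n k) \<longlonglongrightarrow> b k"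
    and bound: "\<forall>\<^sub>F n in sequentially. \<forall>k. norm (a n k) * R ^ k \<le> M k"
    and M: "summable M" and R: "R \<ge> 0"
  shows "uniform_limit (cball 0 R) (\<lambda>n z. \<Sum>k. a n k * z ^ k) (\<lambda>z. \<Sum>k. b k * z ^ k) sequentially"
    and "bounded ((\<lambda>z. \<Sum>k. b k * z ^ k) ` cball 0 R)"
proof -
  \<comment> \<open>The limit coefficients inherit the majorant as \<open>n\<close> tends to
    infinity, so the differences are dominated by \<open>2 * M k\<close>.\<close>
  have b: "norm (b k) * R ^ k \<le> M k" for k
  proof (rule tendsto_upperbound)
    show "(\<lambda>n. norm (a n k) * R ^ k) \<longlonglongrightarrow> norm (b k) * R ^ k"
      by (intro tendsto_intros lim)
    show "\<forall>\<^sub>F n in sequentially. norm (a n k) * R ^ k \<le> M k"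
      using bound by eventually_elim blast
  qed simp
  have term_le: "norm (c * z ^ k) \<le> norm c * R ^ k" if "z \<in> cball 0 R" for c z :: complex and k
    using that by (auto simp: norm_mult norm_power intro!: mult_left_mono power_mono)
  have sm: "summable (\<lambda>k. norm (c k * z ^ k))"
    if "\<And>k. norm (c k) * R ^ k \<le> M k" "z \<in> cball 0 R" for c :: "nat \<Rightarrow> complex" and z
    by (rule summable_comparison_test[OF _ M]) (use order_trans[OF term_le[OF that(2)] that(1)] in auto)
  have "norm (\<Sum>k. b k * z ^ k) \<le> (\<Sum>k. M k)" if "z \<in> cball 0 R" for z
  proof -
    have "norm (\<Sum>k. b k * z ^ k) \<le> (\<Sum>k. norm (b k * z ^ k))"
      by (rule summable_norm[OF sm[OF b that]])
    also have "\<dots> \<le> (\<Sum>k. M k)"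
      by (intro suminf_le sm[OF b that] M order_trans[OF term_le[OF that] b])
    finally show ?thesis .
  qed
  then show "bounded ((\<lambda>z. \<Sum>k. b k * z ^ k) ` cball 0 R)" unfolding bounded_iff by blast
  have diff_le: "norm (a n k - b k) * R ^ k \<le> 2 * M k" if "\<forall>k. norm (a n k) * R ^ k \<le> M k" for n k
  proof -
    have "norm (a n k - b k) * R ^ k \<le> (norm (a n k) + norm (b k)) * R ^ k"
      using R by (intro mult_right_mono norm_triangle_ineq4) auto
    also have "\<dots> = norm (a n k) * R ^ k + norm (b k) * R ^ k" by (rule distrib_right)
    also have "\<dots> \<le> M k + M k" by (intro add_mono b that[rule_format])
    finally show ?thesis by simp
  qed
  have M2: "summable (\<lambda>k. 2 * M k)" by (rule summable_mult[OF M])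
  have lim0: "(\<lambda>n. norm (a n k - b k) * R ^ k) \<longlonglongrightarrow> 0" for k
    using tendsto_mult_left_zero[OF tendsto_norm_zero[OF LIM_zero[OF lim]]] .
  have "\<forall>\<^sub>F n in sequentially. \<forall>k. norm (norm (a n k - b k) * R ^ k) \<le> 2 * M k"
    using bound by eventually_elim (use R diff_le in \<open>simp add: abs_mult\<close>)
  \<comment> \<open>Tannery's theorem asks for domination eventually in \<open>k\<close> and
    \<open>n\<close> jointly; here it holds for every \<open>k\<close>, hence the trivial predicate
    in the first component.\<close>
  then have "\<forall>\<^sub>F (k, n) in sequentially \<times>\<^sub>F sequentially.
      norm (norm (a n k - b k) * R ^ k) \<le> 2 * M k"
    unfolding eventually_prod_filter by (intro exI[of _ "\<lambda>_. True"] exI conjI) auto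
  from tannerys_theorem[OF lim0 this M2]
  have "(\<lambda>n. \<Sum>k. norm (a n k - b k) * R ^ k) \<longlonglongrightarrow> (\<Sum>k. 0)" by simp
  then have small: "(\<lambda>n. \<Sum>k. norm (a n k - b k) * R ^ k) \<longlonglongrightarrow> 0" by simp
  show "uniform_limit (cball 0 R) (\<lambda>n z. \<Sum>k. a n k * z ^ k) (\<lambda>z. \<Sum>k. b k * z ^ k) sequentially"
  proof (rule uniform_limitI)
    fix e :: real assume "e > 0"
    from order_tendstoD(2)[OF small this] bound
    show "\<forall>\<^sub>F n in sequentially. \<forall>z\<in>cball 0 R.
        dist (\<Sum>k. a n k * z ^ k) (\<Sum>k. b k * z ^ k) < e"
    proof eventually_elim
      case (elim n)
      show ?case
      proof
        fix z :: complex assume z: "z \<in> cball 0 R"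
        have sa: "summable (\<lambda>k. a n k * z ^ k)"
          by (rule summable_norm_cancel[OF sm[OF elim(2)[rule_format] z]])
        have sb: "summable (\<lambda>k. b k * z ^ k)"
          by (rule summable_norm_cancel[OF sm[OF b z]])
        have sd: "summable (\<lambda>k. norm (a n k - b k) * R ^ k)"
          by (rule summable_comparison_test[OF _ M2])
             (use diff_le[OF elim(2)] R in \<open>auto simp: abs_mult\<close>)
        have sd': "summable (\<lambda>k. norm ((a n k - b k) * z ^ k))"
          by (rule summable_comparison_test[OF _ sd]) (use term_le[OF z] in auto)
        have "dist (\<Sum>k. a n k * z ^ k) (\<Sum>k. b k * z ^ k) = norm (\<Sum>k. (a n k - b k) * z ^ k)"
          unfolding dist_norm by (simp add: suminf_diff[OF sa sb] left_diff_distrib)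
        also have "\<dots> \<le> (\<Sum>k. norm ((a n k - b k) * z ^ k))"
          by (rule summable_norm[OF sd'])
        also have "\<dots> \<le> (\<Sum>k. norm (a n k - b k) * R ^ k)"
          by (rule suminf_le[OF term_le[OF z] sd' sd])
        also have "\<dots> < e" by (rule elim(1))
        finally show "dist (\<Sum>k. a n k * z ^ k) (\<Sum>k. b k * z ^ k) < e" .
      qed
    qed
  qed
qed

section \<open>Pochhammer quotients, floor indices and the prefactor\<close>

text \<open>Splitting \<open>pochhammer x (k + m)\<close> after \<open>k\<close> or after
  \<open>m\<close> factors gives the same product. The swap turns a quotient of products of growing
  length \<open>m\<close> into one of fixed length \<open>k\<close>, whose asymptotics are
  elementary.\<close>

lemma pochhammer_quotient_swap:
  fixes x :: real
  assumes "x > 0"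
  shows "pochhammer (x + real k) m / pochhammer x m = pochhammer (x + real m) k / pochhammer x k"
proof -
  have "pochhammer x k * pochhammer (x + real k) m = pochhammer x m * pochhammer (x + real m) k"
    using pochhammer_product'[of x k m] pochhammer_product'[of x m k] by (simp add: add.commute)
  moreover have "pochhammer x k > 0" "pochhammer x m > 0"
    using assms by (auto intro: pochhammer_pos)
  ultimately show ?thesis by (simp add: field_simps)
qed

lemma floor_index_le:
  assumes "q j \<ge> 0"
  shows "real (floor_index q n j) \<le> q j * real n"
  unfolding floor_index_def using assms by (simp add: of_nat_floor)

lemma floor_index_div_tendsto:
  assumes "q j \<ge> 0"
  shows "(\<lambda>n. real (floor_index q n j) / real n) \<longlonglongrightarrow> q j"
proof (rule tendsto_sandwich)
  have "q j - 1 / real n \<le> real (floor_index q n j) / real n" if "n \<ge> 1" for n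
  proof -
    have "q j * real n - 1 \<le> real (floor_index q n j)"
      unfolding floor_index_def by linarith
    then have "(q j * real n - 1) / real n \<le> real (floor_index q n j) / real n"
      by (intro divide_right_mono) auto
    then show ?thesis using that by (simp add: diff_divide_distrib)
  qed
  then show "\<forall>\<^sub>F n in sequentially. q j - 1 / real n \<le> real (floor_index q n j) / real n"
    using eventually_ge_at_top[of 1] by (rule eventually_mono[rotated])
  have "real (floor_index q n j) / real n \<le> q j" if "n \<ge> 1" for n
    using floor_index_le[of q j n] assms that by (simp add: field_simps)
  then show "\<forall>\<^sub>F n in sequentially. real (floor_index q n j) / real n \<le> q j"
    using eventually_ge_at_top[of 1] by (rule eventually_mono[rotated])
  have "(\<lambda>n. q j - 1 / real n) \<longlonglongrightarrow> q j - 0"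
    by (intro tendsto_intros lim_1_over_n)
  then show "(\<lambda>n. q j - 1 / real n) \<longlonglongrightarrow> q j" by simp
qed simp

lemma norm_div_of_nat_power_le:
  fixes z :: complex
  assumes "norm z \<le> R"
  shows "norm (z / of_nat n ^ m) \<le> R * (1 / real n) ^ m"
  using assms by (auto simp: norm_divide norm_power power_divide intro!: divide_right_mono)

text \<open>The argument \<open>z / of_nat n ^ m\<close> tends to 0 uniformly on the disc, so
  continuity of \<open>(1 - w) powr c\<close> at \<open>w = 0\<close>, where the value is 1,
  suffices.\<close>

lemma uniform_limit_one_minus_powr:
  fixes c :: complex
  assumes "m > 0"
  shows "uniform_limit (cball 0 R) (\<lambda>n z. (1 - z / of_nat n ^ m) powr c) (\<lambda>_. 1) sequentially"
proof (rule uniform_limitI)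
  fix e :: real assume "e > 0"
  have "isCont (\<lambda>w. (1 - w) powr c) 0"
    by (intro continuous_intros) auto
  then obtain d where d: "d > 0" "\<And>w. norm w < d \<Longrightarrow> dist ((1 - w) powr c) 1 < e"
    using \<open>e > 0\<close> unfolding continuous_at_eps_delta by (force simp: dist_norm)
  have "(\<lambda>n. R * (1 / real n) ^ m) \<longlonglongrightarrow> R * 0 ^ m"
    by (intro tendsto_intros lim_1_over_n)
  then have "(\<lambda>n. R * (1 / real n) ^ m) \<longlonglongrightarrow> 0"
    by (simp only: zero_power[OF assms] mult_zero_right)
  from order_tendstoD(2)[OF this \<open>d > 0\<close>]
  show "\<forall>\<^sub>F n in sequentially. \<forall>z\<in>cball 0 R. dist ((1 - z / of_nat n ^ m) powr c) 1 < e"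
  proof eventually_elim
    case (elim n)
    show ?case
    proof
      fix z :: complex assume "z \<in> cball 0 R"
      then have "norm (z / of_nat n ^ m) \<le> R * (1 / real n) ^ m"
        by (intro norm_div_of_nat_power_le) simp
      then show "dist ((1 - z / of_nat n ^ m) powr c) 1 < e" using elim by (intro d) linarith
    qed
  qed
qed

section \<open>Identity, limits and bounds for the rescaled coefficients\<close>

text \<open>For \<open>\<gamma> = \<bar>N\<bar> + \<beta>\<close>, the coefficient of \<open>z\<^sup>k\<close> in \<open>(1 - x)\<^sup>\<beta>\<close> times the normalised polynomial at
  \<open>x = z / n\<^sup>r\<^sup>+\<^sup>1\<close>.\<close>

definition scaled_coeff ::
    "nat \<Rightarrow> (nat \<Rightarrow> real) \<Rightarrow> (nat \<Rightarrow> nat) \<Rightarrow> real \<Rightarrow> nat \<Rightarrow> nat \<Rightarrow> real"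
  where "scaled_coeff r \<alpha> N \<gamma> n k =
    (\<Prod>j=1..r. pochhammer (\<alpha> j + 1 + real (N j)) k / (real n ^ k * pochhammer (\<alpha> j + 1) k))
      * (pochhammer (- \<gamma>) k / (real n ^ k * pochhammer 1 k))"

text \<open>This is \<open>jacobi_pineiro_sums\<close> at the rescaled point \<open>x\<close>,
  divided by \<open>C\<close> and by the power \<beta> of \<open>1 - x\<close>;
  \<open>pochhammer_quotient_swap\<close> brings the coefficients into the form of
  \<open>scaled_coeff\<close>.\<close>

lemma jacobi_pineiro_scaled:
  fixes z :: complex and N :: "nat \<Rightarrow> nat"
  assumes \<alpha>: "\<And>j. j \<in> {1..r} \<Longrightarrow> \<alpha> j > -1" and \<beta>: "\<beta> > -1"
    and n: "n > 0" and z: "norm (z / of_nat n ^ (r + 1)) < 1"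
  defines "s \<equiv> multi_size r N"
  shows "(-1) ^ s
      * complex_of_real (\<Prod>j=1..r. pochhammer (real s + \<alpha> j + \<beta> + 1) (N j) / pochhammer (\<alpha> j + 1) (N j))
      * poly (map_poly complex_of_real (jacobi_pineiro r N \<alpha> \<beta>)) (z / of_nat n ^ (r + 1))
    = (1 - z / of_nat n ^ (r + 1)) powr (- complex_of_real \<beta>)
      * (\<Sum>k. complex_of_real (scaled_coeff r \<alpha> N (real s + \<beta>) n k) * z ^ k)"
    (is "?L = ?g * _")
proof -
  define x where "x = z / of_nat n ^ (r + 1)"
  define C where "C = (\<Prod>j=1..r. pochhammer (\<alpha> j + 1) (N j))"
  define c where "c k = (\<Prod>j=1..r. pochhammer (\<alpha> j + real k + 1) (N j))
        * (pochhammer (- (real s + \<beta>)) k / fact k)" for k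
  have coeff: "complex_of_real (c k) * x ^ k / complex_of_real C
      = complex_of_real (scaled_coeff r \<alpha> N (real s + \<beta>) n k) * z ^ k" for k
  proof -
    have "(\<Prod>j=1..r. pochhammer (\<alpha> j + real k + 1) (N j)) / C
        = (\<Prod>j=1..r. pochhammer (\<alpha> j + 1 + real (N j)) k / pochhammer (\<alpha> j + 1) k)"
      unfolding C_def prod_dividef[symmetric]
    proof (rule prod.cong[OF refl])
      fix j assume "j \<in> {1..r}"
      then show "pochhammer (\<alpha> j + real k + 1) (N j) / pochhammer (\<alpha> j + 1) (N j)
          = pochhammer (\<alpha> j + 1 + real (N j)) k / pochhammer (\<alpha> j + 1) k"
        using pochhammer_quotient_swap[of "\<alpha> j + 1" k "N j"] \<alpha>[of j] by (simp add: add_ac)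
    qed
    \<comment> \<open>Each of the \<open>r\<close> quotients takes one factor \<open>n ^ k\<close>
      and the binomial coefficient takes another; together they make up the denominator of
      \<open>x ^ k\<close>.\<close>
    moreover have "(\<Prod>j=1..r. pochhammer (\<alpha> j + 1 + real (N j)) k / (real n ^ k * pochhammer (\<alpha> j + 1) k))
        = (\<Prod>j=1..r. pochhammer (\<alpha> j + 1 + real (N j)) k / pochhammer (\<alpha> j + 1) k) / real n ^ (r * k)"
      by (simp add: prod_dividef prod.distrib power_mult mult.commute)
    ultimately have "scaled_coeff r \<alpha> N (real s + \<beta>) n k
        = (\<Prod>j=1..r. pochhammer (\<alpha> j + real k + 1) (N j)) / C / real n ^ (r * k)
          * (pochhammer (- (real s + \<beta>)) k / (real n ^ k * fact k))"
      by (simp only: scaled_coeff_def pochhammer_fact)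
    also have "\<dots> = c k / C / real n ^ ((r + 1) * k)"
      by (simp add: c_def power_add mult_ac)
    finally have "complex_of_real (scaled_coeff r \<alpha> N (real s + \<beta>) n k)
        = complex_of_real (c k) / complex_of_real C / of_nat n ^ ((r + 1) * k)" by simp
    moreover have "x ^ k = z ^ k / of_nat n ^ ((r + 1) * k)"
      by (simp only: x_def power_divide power_mult)
    ultimately show ?thesis by simp
  qed
  \<comment> \<open>A power with base 0 is 0 under \<open>powr\<close>, so this is what permits
    division by the power of \<open>1 - x\<close>.\<close>
  have "x \<noteq> 1" using z unfolding x_def by auto
  then have g: "(1 - x) powr complex_of_real \<beta> \<noteq> 0" by simp
  have "(\<lambda>k. complex_of_real (c k) * x ^ k) sums
    ((-1) ^ s * complex_of_real (\<Prod>j=1..r. pochhammer (real s + \<alpha> j + \<beta> + 1) (N j))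
      * (1 - x) powr complex_of_real \<beta>
      * poly (map_poly complex_of_real (jacobi_pineiro r N \<alpha> \<beta>)) x)"
    unfolding c_def s_def using jacobi_pineiro_sums[of r \<alpha> \<beta> x N] \<alpha> \<beta> z x_def by blast
  from sums_divide[OF this, of "complex_of_real C"]
  have "(\<lambda>k. complex_of_real (scaled_coeff r \<alpha> N (real s + \<beta>) n k) * z ^ k) sums
      ((1 - x) powr complex_of_real \<beta> * ?L)"
    unfolding coeff by (simp add: C_def x_def prod_dividef mult_ac)
  then have "(\<Sum>k. complex_of_real (scaled_coeff r \<alpha> N (real s + \<beta>) n k) * z ^ k)
      = (1 - x) powr complex_of_real \<beta> * ?L"
    by (simp add: sums_iff)
  then have "?g * (\<Sum>k. complex_of_real (scaled_coeff r \<alpha> N (real s + \<beta>) n k) * z ^ k)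
      = (?g * (1 - x) powr complex_of_real \<beta>) * ?L"
    by (simp only: mult.assoc)
  also have "?g * (1 - x) powr complex_of_real \<beta> = 1"
    using g by (simp add: x_def powr_minus)
  finally show ?thesis by (simp only: mult_1)
qed

text \<open>For fixed \<open>k\<close> every base is asymptotically linear in \<open>n\<close>:
  \<open>(\<alpha> j + 1 + N n j) / n\<close> tends to \<open>q j\<close>, and
  \<open>- \<gamma> n / n\<close> tends to -1.\<close>

lemma scaled_coeff_tendsto:
  assumes "\<And>j. j \<in> {1..r} \<Longrightarrow> \<alpha> j > -1"
    and "\<And>j. j \<in> {1..r} \<Longrightarrow> (\<lambda>n. real (N n j) / real n) \<longlonglongrightarrow> q j"
    and "(\<lambda>n. \<gamma> n / real n) \<longlonglongrightarrow> 1"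
  shows "(\<lambda>n. scaled_coeff r \<alpha> (N n) (\<gamma> n) n k) \<longlonglongrightarrow>
    (\<Prod>j=1..r. q j ^ k / pochhammer (\<alpha> j + 1) k) * ((-1) ^ k / fact k)"
proof -
  have "(\<lambda>n. pochhammer (\<alpha> j + 1 + real (N n j)) k / real n ^ k / pochhammer (\<alpha> j + 1) k)
      \<longlonglongrightarrow> q j ^ k / pochhammer (\<alpha> j + 1) k" if j: "j \<in> {1..r}" for j
  proof (intro tendsto_divide pochhammer_div_power_tendsto tendsto_const)
    have "(\<lambda>n. (\<alpha> j + 1) / real n + real (N n j) / real n) \<longlonglongrightarrow> 0 + q j"
      by (intro tendsto_add lim_const_over_n assms(2) j)
    then show "(\<lambda>n. (\<alpha> j + 1 + real (N n j)) / real n) \<longlonglongrightarrow> q j"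
      by (simp add: add_divide_distrib)
    show "pochhammer (\<alpha> j + 1) k \<noteq> 0"
      using pochhammer_pos[of "\<alpha> j + 1" k] assms(1)[OF j] by simp
  qed
  moreover have "(\<lambda>n. pochhammer (- \<gamma> n) k / real n ^ k / pochhammer 1 k) \<longlonglongrightarrow> (-1) ^ k / pochhammer 1 k"
    using tendsto_minus[OF assms(3)]
    by (intro tendsto_divide pochhammer_div_power_tendsto tendsto_const) (simp_all flip: pochhammer_fact)
  ultimately show ?thesis
    unfolding scaled_coeff_def pochhammer_fact divide_divide_eq_left[symmetric]
    by (intro tendsto_mult tendsto_prod) 
qed

text \<open>Smallness is drawn from the last factor alone, bounded by
  \<open>A0 * \<epsilon> ^ k\<close>; the other \<open>r\<close> factors are kept bounded by
  applying \<open>pochhammer_ratio_bound\<close> with 1 in place of \<epsilon>.\<close>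

lemma scaled_coeff_bound:
  assumes \<alpha>: "\<And>j. j \<in> {1..r} \<Longrightarrow> \<alpha> j > -1"
    and N: "\<And>n j. j \<in> {1..r} \<Longrightarrow> N n j \<le> n"
    and \<gamma>: "\<And>n. n > 0 \<Longrightarrow> \<bar>\<gamma> n\<bar> \<le> B * real n" and "\<epsilon> > 0"
  shows "\<exists>A. \<forall>\<^sub>F n in sequentially. \<forall>k. \<bar>scaled_coeff r \<alpha> (N n) (\<gamma> n) n k\<bar> \<le> A * \<epsilon> ^ k"
proof -
  have "B \<ge> 0" using \<gamma>[of 1] by simp
  then obtain A0 where A0: "A0 \<ge> 0" "\<forall>\<^sub>F n in sequentially. \<forall>x k. \<bar>x\<bar> \<le> B * real n \<longrightarrow>
      \<bar>pochhammer x k\<bar> / (real n ^ k * pochhammer 1 k) \<le> A0 * \<epsilon> ^ k"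
    using pochhammer_ratio_bound[OF zero_less_one _ \<open>\<epsilon> > 0\<close>] by blast
  have "\<forall>j\<in>{1..r}. \<exists>A\<ge>0. \<forall>\<^sub>F n in sequentially. \<forall>x k. \<bar>x\<bar> \<le> (\<alpha> j + 2) * real n \<longrightarrow>
      \<bar>pochhammer x k\<bar> / (real n ^ k * pochhammer (\<alpha> j + 1) k) \<le> A * 1 ^ k"
  proof
    fix j assume "j \<in> {1..r}"
    from \<alpha>[OF this] show "\<exists>A\<ge>0. \<forall>\<^sub>F n in sequentially. \<forall>x k. \<bar>x\<bar> \<le> (\<alpha> j + 2) * real n \<longrightarrow>
      \<bar>pochhammer x k\<bar> / (real n ^ k * pochhammer (\<alpha> j + 1) k) \<le> A * 1 ^ k"
      by (intro pochhammer_ratio_bound) auto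
  qed
  from bchoice[OF this] obtain A where A: "\<And>j. j \<in> {1..r} \<Longrightarrow> A j \<ge> 0"
    "\<And>j. j \<in> {1..r} \<Longrightarrow> \<forall>\<^sub>F n in sequentially. \<forall>x k. \<bar>x\<bar> \<le> (\<alpha> j + 2) * real n \<longrightarrow>
      \<bar>pochhammer x k\<bar> / (real n ^ k * pochhammer (\<alpha> j + 1) k) \<le> A j * 1 ^ k"
    by blast
  have "\<forall>\<^sub>F n in sequentially. \<forall>j\<in>{1..r}. \<forall>x k. \<bar>x\<bar> \<le> (\<alpha> j + 2) * real n \<longrightarrow>
      \<bar>pochhammer x k\<bar> / (real n ^ k * pochhammer (\<alpha> j + 1) k) \<le> A j * 1 ^ k"
    using A(2) by (intro eventually_ball_finite) auto
  then have "\<forall>\<^sub>F n in sequentially. \<forall>k.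
      \<bar>scaled_coeff r \<alpha> (N n) (\<gamma> n) n k\<bar> \<le> (\<Prod>j=1..r. A j) * A0 * \<epsilon> ^ k"
    using A0(2) eventually_gt_at_top[of 0]
  proof eventually_elim
    case (elim n)
    show ?case
    proof
      fix k
      have pos: "pochhammer (\<alpha> j + 1) k > 0" if "j \<in> {1..r}" for j
        using \<alpha>[OF that] by (intro pochhammer_pos) simp
      have "\<bar>pochhammer (\<alpha> j + 1 + real (N n j)) k / (real n ^ k * pochhammer (\<alpha> j + 1) k)\<bar> \<le> A j"
        if j: "j \<in> {1..r}" for j
      proof -
        \<comment> \<open>For \<open>n \<ge> 1\<close> this combines with
          \<open>N n j \<le> n\<close>, which is where the constant \<open>\<alpha> j + 2\<close>
          comes from.\<close>
        have "\<alpha> j + 1 \<le> (\<alpha> j + 1) * real n" using \<alpha>[OF j] elim(3) by simp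
        then have "\<bar>\<alpha> j + 1 + real (N n j)\<bar> \<le> (\<alpha> j + 2) * real n"
          using \<alpha>[OF j] N[OF j, of n] by (simp add: algebra_simps)
        then show ?thesis using elim(1) j pos[OF j] by (auto simp: abs_mult)
      qed
      then have "\<bar>\<Prod>j=1..r. pochhammer (\<alpha> j + 1 + real (N n j)) k / (real n ^ k * pochhammer (\<alpha> j + 1) k)\<bar>
          \<le> (\<Prod>j=1..r. A j)"
        unfolding abs_prod by (intro prod_mono) auto
      moreover have "\<bar>pochhammer (- \<gamma> n) k / (real n ^ k * pochhammer 1 k)\<bar> \<le> A0 * \<epsilon> ^ k"
        using elim(2)[rule_format, of "- \<gamma> n" k] \<gamma>[OF elim(3)] pochhammer_pos[of "1::real" k]
        by (simp add: abs_mult)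
      ultimately show "\<bar>scaled_coeff r \<alpha> (N n) (\<gamma> n) n k\<bar> \<le> (\<Prod>j=1..r. A j) * A0 * \<epsilon> ^ k"
        unfolding scaled_coeff_def abs_mult[of "prod _ _"] mult.assoc
        by (intro mult_mono) (auto intro!: prod_nonneg A)
    qed
  qed
  then show ?thesis by blast
qed

section \<open>Uniform convergence on compact sets\<close>

theorem theorem2:
  fixes r :: nat and \<alpha> q :: "nat \<Rightarrow> real" and \<beta> :: real
  assumes "r \<ge> 1"
    and "\<And>j. j \<in> {1..r} \<Longrightarrow> \<alpha> j > -1"
    and "\<beta> > -1"
    and "\<And>i j. i \<in> {1..r} \<Longrightarrow> j \<in> {1..r} \<Longrightarrow> i \<noteq> j \<Longrightarrow> \<alpha> i - \<alpha> j \<notin> \<int>"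
    and "\<And>j. j \<in> {1..r} \<Longrightarrow> q j > 0"
    and "(\<Sum>j=1..r. q j) = 1"
  shows "\<forall>K :: complex set. compact K \<longrightarrow>
    uniform_limit K
      (\<lambda>n z. let N = floor_index q n; s = multi_size r N in
         (-1) ^ s
         * complex_of_real (\<Prod>j=1..r.
             pochhammer (real s + \<alpha> j + \<beta> + 1) (N j) / pochhammer (\<alpha> j + 1) (N j))
         * poly (map_poly complex_of_real (jacobi_pineiro r N \<alpha> \<beta>)) (z / of_nat n ^ (r + 1)))
      (\<lambda>z. hypergeom_0F r (\<lambda>j. complex_of_real (\<alpha> j + 1)) (- complex_of_real (\<Prod>j=1..r. q j) * z))
      sequentially"
proof (intro allI impI)
  fix K :: "complex set" assume "compact K"
  then have "bounded K" by (rule compact_imp_bounded)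
  then obtain R where "R > 0" "\<forall>x\<in>K. norm x \<le> R"
    unfolding bounded_pos by blast
  then have R: "R > 0" "K \<subseteq> cball 0 R" by auto
  define N where "N = floor_index q"
  define s where "s n = multi_size r (N n)" for n
  define a where "a n = scaled_coeff r \<alpha> (N n) (real (s n) + \<beta>) n" for n
  define b where "b k = (\<Prod>j=1..r. q j ^ k / pochhammer (\<alpha> j + 1) k) * ((-1) ^ k / fact k)" for k
  have q: "q j \<ge> 0" if "j \<in> {1..r}" for j using assms(5)[OF that] by simp
  have Nlim: "(\<lambda>n. real (N n j) / real n) \<longlonglongrightarrow> q j" if "j \<in> {1..r}" for j
    unfolding N_def by (rule floor_index_div_tendsto[of q, OF q[OF that]])
  have s: "real (s n) = (\<Sum>j=1..r. real (N n j))" for n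
    by (simp add: s_def multi_size_def)
  have slim: "(\<lambda>n. (real (s n) + \<beta>) / real n) \<longlonglongrightarrow> 1"
  proof -
    have "(\<lambda>n. (\<Sum>j=1..r. real (N n j) / real n) + \<beta> / real n) \<longlonglongrightarrow> (\<Sum>j=1..r. q j) + 0"
      by (intro tendsto_add tendsto_sum Nlim lim_const_over_n)
    then show ?thesis by (simp only: s assms(6) add_divide_distrib sum_divide_distrib add_0_right)
  qed
  \<comment> \<open>Since the \<open>q j\<close> sum to 1, rounding down gives
    \<open>s n \<le> n\<close>, hence \<open>N n j \<le> n\<close> and a linear bound for
    \<open>s n + \<beta>\<close>.\<close>
  have "real (s n) \<le> (\<Sum>j=1..r. q j * real n)" for n
    unfolding s N_def by (rule sum_mono) (rule floor_index_le[of q, OF q])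
  then have s_le: "s n \<le> n" for n
    unfolding sum_distrib_right[symmetric] assms(6) by simp
  have N_le: "N n j \<le> n" if "j \<in> {1..r}" for n j
  proof -
    have "N n j \<le> s n"
      unfolding s_def multi_size_def using that member_le_sum[of j "{1..r}" "N n"] by simp
    then show ?thesis using s_le[of n] by linarith
  qed
  have \<gamma>: "\<bar>real (s n) + \<beta>\<bar> \<le> (1 + \<bar>\<beta>\<bar>) * real n" if "n > 0" for n
  proof -
    have "\<bar>\<beta>\<bar> \<le> \<bar>\<beta>\<bar> * real n" using that by (simp add: mult_le_cancel_left1)
    then show ?thesis using s_le[of n] by (simp add: algebra_simps)
  qed
  \<comment> \<open>With this choice of \<epsilon> the bound
    \<open>A * \<epsilon> ^ k * R ^ k\<close> becomes \<open>A * (1 / 2) ^ k\<close>, a summable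
    majorant on the disc of radius \<open>R\<close>.\<close>
  have "1 / (2 * R) > 0" using R(1) by simp
  from scaled_coeff_bound[where r = r and \<alpha> = \<alpha> and N = N and \<gamma> = "\<lambda>n. real (s n) + \<beta>", OF assms(2) N_le \<gamma> this]
  obtain A where A: "\<forall>\<^sub>F n in sequentially. \<forall>k. \<bar>a n k\<bar> \<le> A * (1 / (2 * R)) ^ k"
    unfolding a_def by blast
  have lim: "(\<lambda>n. complex_of_real (a n k)) \<longlonglongrightarrow> complex_of_real (b k)" for k
    unfolding a_def b_def
    by (rule tendsto_of_real) (rule scaled_coeff_tendsto[of r \<alpha> N q, OF assms(2) Nlim slim])
  have bound: "\<forall>\<^sub>F n in sequentially. \<forall>k. norm (complex_of_real (a n k)) * R ^ k \<le> A * (1 / 2) ^ k"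
    using A
  proof eventually_elim
    case (elim n)
    show ?case
    proof
      fix k
      have "\<bar>a n k\<bar> * R ^ k \<le> A * (1 / (2 * R)) ^ k * R ^ k"
        using elim R(1) by (intro mult_right_mono) auto
      also have "\<dots> = A * (1 / 2) ^ k"
        using R(1) by (simp add: power_mult_distrib power_divide)
      finally show "norm (complex_of_real (a n k)) * R ^ k \<le> A * (1 / 2) ^ k" by simp
    qed
  qed
  have "summable (\<lambda>k. A * (1 / 2 :: real) ^ k)" by (intro summable_mult summable_geometric) simp
  note series = uniform_limit_powser[OF lim bound this less_imp_le[OF R(1)]]
  \<comment> \<open>The prefactor tends uniformly to 1 and the series to its limit; both limits are
    bounded, so the products converge uniformly.\<close>
  have "uniform_limit (cball 0 R)
      (\<lambda>n z. (1 - z / of_nat n ^ (r + 1)) powr (- complex_of_real \<beta>) * (\<Sum>k. complex_of_real (a n k) * z ^ k))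
      (\<lambda>z. 1 * (\<Sum>k. complex_of_real (b k) * z ^ k)) sequentially"
    by (intro uniform_lim_mult uniform_limit_one_minus_powr series) (auto simp: image_constant_conv)
  then have lim_K: "uniform_limit K
      (\<lambda>n z. (1 - z / of_nat n ^ (r + 1)) powr (- complex_of_real \<beta>) * (\<Sum>k. complex_of_real (a n k) * z ^ k))
      (\<lambda>z. 1 * (\<Sum>k. complex_of_real (b k) * z ^ k)) sequentially"
    by (rule uniform_limit_on_subset[OF _ R(2)])
  have "(\<lambda>n. R * (1 / real n) ^ (r + 1)) \<longlonglongrightarrow> R * 0 ^ (r + 1)"
    by (intro tendsto_intros lim_1_over_n)
  then have small: "(\<lambda>n. R * (1 / real n) ^ (r + 1)) \<longlonglongrightarrow> 0" by simp
  \<comment> \<open>Once \<open>R / n ^ (r + 1)\<close> is below 1, every \<open>z\<close> in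
    \<open>K\<close> is rescaled into the unit disc, where the series identity holds.\<close>
  have ev: "\<forall>\<^sub>F n in sequentially. \<forall>z\<in>K.
      (1 - z / of_nat n ^ (r + 1)) powr (- complex_of_real \<beta>) * (\<Sum>k. complex_of_real (a n k) * z ^ k)
      = (let N = floor_index q n; s = multi_size r N in
         (-1) ^ s
         * complex_of_real (\<Prod>j=1..r.
             pochhammer (real s + \<alpha> j + \<beta> + 1) (N j) / pochhammer (\<alpha> j + 1) (N j))
         * poly (map_poly complex_of_real (jacobi_pineiro r N \<alpha> \<beta>)) (z / of_nat n ^ (r + 1)))"
    using order_tendstoD(2)[OF small zero_less_one] eventually_gt_at_top[of 0]
  proof eventually_elim
    case (elim n)
    show ?case
    proof
      fix z assume "z \<in> K"
      then have "norm z \<le> R" using R(2) by auto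
      then have "norm (z / of_nat n ^ (r + 1)) \<le> R * (1 / real n) ^ (r + 1)"
        by (rule norm_div_of_nat_power_le)
      then have "norm (z / of_nat n ^ (r + 1)) < 1" using elim(1) by linarith
      from jacobi_pineiro_scaled[where r = r and \<alpha> = \<alpha> and N = "N n", OF assms(2,3) elim(2) this]
      show "(1 - z / of_nat n ^ (r + 1)) powr (- complex_of_real \<beta>) * (\<Sum>k. complex_of_real (a n k) * z ^ k)
          = (let N = floor_index q n; s = multi_size r N in
             (-1) ^ s
             * complex_of_real (\<Prod>j=1..r.
                 pochhammer (real s + \<alpha> j + \<beta> + 1) (N j) / pochhammer (\<alpha> j + 1) (N j))
             * poly (map_poly complex_of_real (jacobi_pineiro r N \<alpha> \<beta>)) (z / of_nat n ^ (r + 1)))"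
        by (simp only: Let_def a_def s_def N_def)
    qed
  qed
  \<comment> \<open>The sign and the powers of the \<open>q j\<close> merge into the
    \<open>k\<close>-th power of the argument, which gives the terms of the hypergeometric
    series.\<close>
  have "complex_of_real (b k) * z ^ k
      = (- complex_of_real (\<Prod>j=1..r. q j) * z) ^ k
        / ((\<Prod>j=1..r. pochhammer (complex_of_real (\<alpha> j + 1)) k) * fact k)" for k z
  proof -
    have "complex_of_real (b k) * z ^ k
        = complex_of_real (\<Prod>j=1..r. q j) ^ k / (\<Prod>j=1..r. complex_of_real (pochhammer (\<alpha> j + 1) k))
          * ((-1) ^ k / fact k) * z ^ k"
      by (simp add: b_def prod_dividef prod_power_distrib)
    also have "\<dots> = (-1) ^ k * (complex_of_real (\<Prod>j=1..r. q j) ^ k * z ^ k)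
        / ((\<Prod>j=1..r. complex_of_real (pochhammer (\<alpha> j + 1) k)) * fact k)"
      by simp
    also have "(-1) ^ k * (complex_of_real (\<Prod>j=1..r. q j) ^ k * z ^ k)
        = (- complex_of_real (\<Prod>j=1..r. q j) * z) ^ k"
      by (simp only: power_mult_distrib[symmetric]) simp
    finally show ?thesis by (simp only: pochhammer_of_real)
  qed
  then have eq: "1 * (\<Sum>k. complex_of_real (b k) * z ^ k)
      = hypergeom_0F r (\<lambda>j. complex_of_real (\<alpha> j + 1)) (- complex_of_real (\<Prod>j=1..r. q j) * z)" for z
    unfolding hypergeom_0F_def by simp
  show "uniform_limit K
      (\<lambda>n z. let N = floor_index q n; s = multi_size r N in
         (-1) ^ s
         * complex_of_real (\<Prod>j=1..r.
             pochhammer (real s + \<alpha> j + \<beta> + 1) (N j) / pochhammer (\<alpha> j + 1) (N j))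
         * poly (map_poly complex_of_real (jacobi_pineiro r N \<alpha> \<beta>)) (z / of_nat n ^ (r + 1)))
      (\<lambda>z. hypergeom_0F r (\<lambda>j. complex_of_real (\<alpha> j + 1)) (- complex_of_real (\<Prod>j=1..r. q j) * z))
      sequentially"
    by (rule uniform_limit_cong[OF ev eq, THEN iffD1, OF lim_K])
qed

end
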